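(* Let $\kappa$ be an infinite cardinal and let $X$ be a locally $\kappa$ space. Then $X$ contains an infinite clopen subset $Y$ of cardinality $|Y|\le 2^{2^{\kappa}}$.
   Context: "Space" means infinite Hausdorff topological space. A space $X$ is locally $\kappa$ if every point of $X$ has a neighbourhood of cardinality $\le\kappa$. *)

theory Defs
  imports "HOL-Analysis.T1_Spaces"
begin

unbundle cardinal_syntax

text \<open>
  The cardinal \<open>\<kappa>\<close> is a cardinal order on an arbitrary type, unrelated to the type of points.
  A neighbourhood of \<open>x\<close> is a set with \<open>x\<close> in its interior; it need not be open.
\<close>

definition locally_card_le :: "'b rel \<Rightarrow> 'a topology \<Rightarrow> bool" where
  "locally_card_le \<kappa> X \<longleftrightarrow>
     (\<forall>x \<in> topspace X. \<exists>U N. openin X U \<and> x \<in> U \<and> U \<subseteq> N \<and> N \<subseteq> topspace X \<and> |N| \<le>o \<kappa>)"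

end

theory Submission
  imports Defs
begin

text \<open>
  In a Hausdorff space a point of the closure of \<open>B\<close> is determined by the traces on \<open>B\<close> of its
  open neighbourhoods, so sets of cardinality at most \<open>\<kappa>\<close> have closures of cardinality at most
  \<open>\<mu> = 2^(2^\<kappa>)\<close>. In a locally \<open>\<kappa>\<close> space every point of the closure of \<open>Y\<close> lies in the closure of a
  subset of \<open>Y\<close> of cardinality at most \<open>\<kappa>\<close>. Hence \<open>Y\<close> is clopen as soon as it contains, with every
  subset \<open>B\<close> of cardinality at most \<open>\<kappa>\<close>, the closure of \<open>B\<close> and a small neighbourhood of every point
  of \<open>B\<close>. Since \<open>\<mu>^\<kappa> = \<mu>\<close>, iterating this closing-off process \<open>\<kappa>\<^sup>+\<close> times from a countable set
  yields such a \<open>Y\<close> of cardinality at most \<open>\<mu>\<close>.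
\<close>

text \<open>Each such \<open>B\<close> is the range of a function from \<open>Field \<kappa>\<close>
  to \<open>A\<close>. The empty set is left out because it is no such range once
  \<open>Field \<kappa>\<close> is nonempty.\<close>

lemma card_of_bounded_subsets:
  assumes "Card_order \<kappa>"
  shows "|{B. B \<subseteq> A \<and> B \<noteq> {} \<and> |B| \<le>o \<kappa>}| \<le>o |A| ^c \<kappa>"
proof -
  have "{B. B \<subseteq> A \<and> B \<noteq> {} \<and> |B| \<le>o \<kappa>} \<subseteq> (\<lambda>f. f ` Field \<kappa>) ` Func (Field \<kappa>) A"
  proof clarify
    fix B assume B: "B \<subseteq> A" "B \<noteq> {}" "|B| \<le>o \<kappa>"
    then have "|B| \<le>o |Field \<kappa>|"
      using assms card_of_Field_ordIso ordIso_symmetric ordLeq_ordIso_trans by blast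
    then obtain g where g: "g ` Field \<kappa> = B"
      using B card_of_ordLeq2 by metis
    \<comment> \<open>Members of \<open>Func\<close> must take the value \<open>undefined\<close>
      off their domain.\<close>
    define f where "f = (\<lambda>a. if a \<in> Field \<kappa> then g a else undefined)"
    have "B = f ` Field \<kappa>" "f \<in> Func (Field \<kappa>) A"
      using g B by (auto simp: f_def Func_def)
    then show "B \<in> (\<lambda>f. f ` Field \<kappa>) ` Func (Field \<kappa>) A"
      by blast
  qed
  then show ?thesis
    unfolding cexp_def Field_card_of by (rule surj_imp_ordLeq)
qed

text \<open>This keeps one closing-off step within \<mu>: by \<open>exp\<close> there are at most
  \<mu> sets \<open>B\<close>, and each contributes at most \<mu> points. The empty \<open>B\<close>
  is added separately.\<close>

lemma card_of_UN_bounded_subsets: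
  assumes \<kappa>: "Cinfinite \<kappa>" and \<mu>: "Cinfinite \<mu>" and exp: "\<mu> ^c \<kappa> \<le>o \<mu>"
    and A: "|A| \<le>o \<mu>" and G: "\<And>B. |B| \<le>o \<kappa> \<Longrightarrow> |G B| \<le>o \<mu>"
  shows "|\<Union>B\<in>{B. B \<subseteq> A \<and> |B| \<le>o \<kappa>}. G B| \<le>o \<mu>"
proof -
  let ?S = "{B. B \<subseteq> A \<and> B \<noteq> {} \<and> |B| \<le>o \<kappa>}"
  have "|?S| \<le>o |A| ^c \<kappa>"
    using \<kappa> card_of_bounded_subsets by blast
  also have "|A| ^c \<kappa> \<le>o \<mu> ^c \<kappa>"
    using \<kappa> A cexp_mono1 by blast
  also note exp
  finally have "|\<Union>B\<in>?S. G B| \<le>o \<mu>"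
    using G \<mu> by (intro UNION_Cinfinite_bound) auto
  moreover have "|G {}| \<le>o \<mu>"
    using \<kappa> by (intro G) (auto simp: card_of_empty1 card_order_on_def)
  ultimately have "|(\<Union>B\<in>?S. G B) \<union> G {}| \<le>o \<mu>"
    using \<mu> by (intro Un_Cinfinite_bound)
  moreover have "(\<Union>B\<in>{B. B \<subseteq> A \<and> |B| \<le>o \<kappa>}. G B) \<subseteq> (\<Union>B\<in>?S. G B) \<union> G {}"
    by blast
  ultimately show ?thesis
    using card_of_mono1 ordLeq_transitive by blast
qed

text \<open>The successor of \<kappa> is regular, so a set of size at most \<kappa> inside the union
  of the stages already lies in one stage, and the next stage absorbs its image under
  \<open>G\<close>.\<close>

lemma ex_closed_superset_bounded:
  fixes \<kappa> :: "'b rel" and \<mu> :: "'c rel" and G :: "'a set \<Rightarrow> 'a set"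
  assumes \<kappa>: "Cinfinite \<kappa>" and \<mu>: "Cinfinite \<mu>" and exp: "\<mu> ^c \<kappa> \<le>o \<mu>"
    and A: "|A| \<le>o \<mu>" and G: "\<And>B. |B| \<le>o \<kappa> \<Longrightarrow> |G B| \<le>o \<mu>"
  obtains Y where "A \<subseteq> Y" "|Y| \<le>o \<mu>" "\<forall>B\<subseteq>Y. |B| \<le>o \<kappa> \<longrightarrow> G B \<subseteq> Y"
proof -
  define r where "r = cardSuc \<kappa>"
  have r: "Cinfinite r" "Card_order r"
    using \<kappa> Cinfinite_cardSuc cardSuc_Card_order by (auto simp: r_def)
  then have wo: "wo_rel r"
    by (simp add: wo_rel_def card_order_on_def)
  \<comment> \<open>Cantor's theorem makes this inequality strict, so the number \<open>r\<close> of
    stages is still at most \<mu>.\<close>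
  have "\<kappa> <o \<mu>"
  proof -
    have "\<kappa> <o ctwo ^c \<kappa>"
      using \<kappa> ordLess_ctwo_cexp by blast
    also have "ctwo ^c \<kappa> \<le>o \<mu> ^c \<kappa>"
      using \<kappa> \<mu> cexp_mono1 ctwo_ordLeq_Cinfinite by blast
    also note exp
    finally show ?thesis .
  qed
  then have r\<mu>: "r \<le>o \<mu>"
    unfolding r_def using \<kappa> \<mu> cardSuc_least by blast
  define E where "E Z = Z \<union> (\<Union>B\<in>{B. B \<subseteq> Z \<and> |B| \<le>o \<kappa>}. G B)" for Z
  define H where "H f i = A \<union> (\<Union>j\<in>underS r i. E (f j))" for f i
  define S where "S = wo_rel.worec r H"
  \<comment> \<open>\<open>H f i\<close> uses \<open>f\<close> only strictly below \<open>i\<close>,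
    so the recursion is well-founded. Successor and limit stages need no separate clauses.\<close>
  have "wo_rel.adm_wo r H"
    by (auto simp: wo_rel.adm_wo_def[OF wo] H_def)
  then have "S = H S"
    unfolding S_def by (rule wo_rel.worec_fixpoint[OF wo])
  then have S: "S i = A \<union> (\<Union>j\<in>underS r i. E (S j))" for i
    by (metis H_def)
  have step: "E (S j) \<subseteq> S i" if "j \<in> underS r i" for i j
    using that S[of i] by blast
  have E_ge: "Z \<subseteq> E Z" for Z
    by (auto simp: E_def)
  have chain: "relChain r S"
    unfolding relChain_def using step E_ge
    by (metis (mono_tags, lifting) underS_I order_refl subset_trans)
  have E_bound: "|E Z| \<le>o \<mu>" if "|Z| \<le>o \<mu>" for Z
    unfolding E_def using that card_of_UN_bounded_subsets[OF \<kappa> \<mu> exp that G] \<mu>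
    by (intro Un_Cinfinite_bound)
  have S_bound: "|S i| \<le>o \<mu>" if "i \<in> Field r" for i
    using that
  proof (induction i rule: wo_rel.well_order_induct[OF wo])
    case (1 i)
    have "|underS r i| \<le>o \<mu>"
      using card_of_underS[OF r(2) 1(2)] r\<mu> ordLess_imp_ordLeq ordLeq_transitive by blast
    moreover have "|E (S j)| \<le>o \<mu>" if "j \<in> underS r i" for j
      using 1(1) that by (intro E_bound) (auto simp: underS_def Field_def)
    ultimately have "|\<Union>j\<in>underS r i. E (S j)| \<le>o \<mu>"
      using \<mu> by (intro UNION_Cinfinite_bound) auto
    then show ?case
      using A \<mu> S[of i] Un_Cinfinite_bound by metis
  qed
  define Y where "Y = (\<Union>i\<in>Field r. S i)"
  show thesis
  proof
    have "Field r \<noteq> {}"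
      using r by (auto simp: cinfinite_def)
    then show "A \<subseteq> Y"
      unfolding Y_def using S by blast
    have "|Field r| \<le>o \<mu>"
      using r r\<mu> card_of_Field_ordIso ordIso_ordLeq_trans by blast
    then show "|Y| \<le>o \<mu>"
      unfolding Y_def using S_bound \<mu> by (intro UNION_Cinfinite_bound) auto
    show "\<forall>B\<subseteq>Y. |B| \<le>o \<kappa> \<longrightarrow> G B \<subseteq> Y"
    proof (intro allI impI)
      fix B assume B: "B \<subseteq> Y" "|B| \<le>o \<kappa>"
      then obtain i where i: "i \<in> Field r" "B \<subseteq> S i"
        using cardSuc_UNION_Cinfinite[OF \<kappa>, of S B] chain by (auto simp: Y_def r_def)
      \<comment> \<open>An infinite cardinal order has no last element, so a later stage
        exists.\<close>
      obtain k where k: "k \<in> Field r" "i \<noteq> k" "(i, k) \<in> r"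
        using infinite_Card_order_limit r i by (metis cinfinite_def)
      have "G B \<subseteq> E (S i)"
        using i B by (auto simp: E_def)
      also have "\<dots> \<subseteq> S k"
        using k by (intro step) (auto simp: underS_def)
      finally show "G B \<subseteq> Y"
        using k by (auto simp: Y_def)
    qed
  qed
qed

lemma card_of_closure_of_Hausdorff:
  assumes "Hausdorff_space X"
  shows "|X closure_of B| \<le>o |Pow (Pow B)|"
proof -
  define t where "t x = {B \<inter> U |U. openin X U \<and> x \<in> U}" for x
  have "inj_on t (X closure_of B)"
  proof (rule inj_onI, rule ccontr)
    fix x y assume x: "x \<in> X closure_of B" and y: "y \<in> X closure_of B"
      and eq: "t x = t y" and "x \<noteq> y"
    then obtain U V where UV: "openin X U" "openin X V" "x \<in> U" "y \<in> V" "disjnt U V"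
      using assms unfolding Hausdorff_space_def by (metis in_closure_of)
    then have "B \<inter> U \<in> t y"
      unfolding eq[symmetric] by (auto simp: t_def)
    then obtain W where W: "openin X W" "y \<in> W" "B \<inter> U = B \<inter> W"
      by (auto simp: t_def)
    then have "openin X (V \<inter> W)" "y \<in> V \<inter> W"
      using UV by auto
    \<comment> \<open>Equal traces put \<open>b\<close> into \<open>U\<close> as well as
      \<open>V\<close>, which are disjoint.\<close>
    then obtain b where "b \<in> B" "b \<in> V \<inter> W"
      using y unfolding in_closure_of by blast
    then show False
      using W UV by (auto simp: disjnt_def)
  qed
  moreover have "t ` (X closure_of B) \<subseteq> Pow (Pow B)"
    by (auto simp: t_def)
  ultimately show ?thesis
    by (auto simp: card_of_ordLeq[symmetric])
qed

lemma card_of_Pow_ordLeq_cexp: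
  assumes "|B| \<le>o r" "Card_order r"
  shows "|Pow B| \<le>o ctwo ^c r"
proof -
  have "|B| \<le>o |Field r|"
    using assms card_of_Field_ordIso ordIso_symmetric ordLeq_ordIso_trans by blast
  then obtain f where "inj_on f B" "f ` B \<subseteq> Field r"
    by (auto simp: card_of_ordLeq[symmetric])
  then have "inj_on (image f) (Pow B)" "image f ` Pow B \<subseteq> Pow (Field r)"
    by (auto simp: inj_on_image_Pow)
  then have "|Pow B| \<le>o |Pow (Field r)|"
    by (auto simp: card_of_ordLeq[symmetric])
  also have "|Pow (Field r)| =o ctwo ^c r"
    unfolding ctwo_def cexp_def Field_card_of by (rule card_of_Pow_Func)
  finally show ?thesis .
qed

theorem theorem2p4:
  fixes \<kappa> :: "'b rel" and X :: "'a topology"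
  assumes "Cinfinite \<kappa>"
    and "infinite (topspace X)"
    and "Hausdorff_space X"
    and "locally_card_le \<kappa> X"
  shows "\<exists>Y. infinite Y \<and> openin X Y \<and> closedin X Y \<and> |Y| \<le>o ctwo ^c (ctwo ^c \<kappa>)"
proof -
  let ?\<mu> = "ctwo ^c (ctwo ^c \<kappa>)"
  note \<kappa> = assms(1)
  have \<kappa>2: "Cinfinite (ctwo ^c \<kappa>)"
    using \<kappa> by (rule Cinfinite_cexp[OF ordLeq_refl[OF Card_order_ctwo]])
  then have \<mu>: "Cinfinite ?\<mu>"
    by (rule Cinfinite_cexp[OF ordLeq_refl[OF Card_order_ctwo]])
  have \<kappa>\<kappa>2: "\<kappa> \<le>o ctwo ^c \<kappa>"
    using \<kappa> ordLess_ctwo_cexp ordLess_imp_ordLeq by blast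
  moreover have "ctwo ^c \<kappa> \<le>o ?\<mu>"
    using \<kappa>2 ordLess_ctwo_cexp ordLess_imp_ordLeq by blast
  ultimately have \<kappa>\<mu>: "\<kappa> \<le>o ?\<mu>"
    by (rule ordLeq_transitive)
  \<comment> \<open>The exponents multiply, and the factor \<kappa> is absorbed by
    \<open>ctwo ^c \<kappa>\<close>.\<close>
  have exp: "?\<mu> ^c \<kappa> \<le>o ?\<mu>"
    using cexp_cprod_ordLeq[OF Card_order_ctwo \<kappa>2 _ \<kappa>\<kappa>2] \<kappa> Cinfinite_Cnotzero ordIso_imp_ordLeq
    by blast
  have "\<exists>U. openin X U \<and> x \<in> U \<and> |U| \<le>o \<kappa>" if "x \<in> topspace X" for x
    using assms(4) that unfolding locally_card_le_def
    by (meson card_of_mono1 ordLeq_transitive)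
  then obtain U where U: "\<And>x. x \<in> topspace X \<Longrightarrow> openin X (U x) \<and> x \<in> U x \<and> |U x| \<le>o \<kappa>"
    by metis
  \<comment> \<open>The closure will make the final set closed, the neighbourhoods will make it
    open. \<open>U\<close> is controlled only at points of the space, hence the
    intersection.\<close>
  define G where "G B = X closure_of B \<union> (\<Union>x\<in>B \<inter> topspace X. U x)" for B
  have G_bound: "|G B| \<le>o ?\<mu>" if B: "|B| \<le>o \<kappa>" for B
  proof -
    have "|X closure_of B| \<le>o |Pow (Pow B)|"
      using assms(3) by (rule card_of_closure_of_Hausdorff)
    also have "|Pow (Pow B)| \<le>o ?\<mu>"
      using B \<kappa> \<kappa>2 by (intro card_of_Pow_ordLeq_cexp) auto
    finally have "|X closure_of B| \<le>o ?\<mu>" .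
    moreover have "|\<Union>x\<in>B \<inter> topspace X. U x| \<le>o ?\<mu>"
      using U B \<kappa>\<mu> \<mu>
      by (intro UNION_Cinfinite_bound) (auto intro: ordLeq_transitive card_of_mono1)
    ultimately show ?thesis
      unfolding G_def using \<mu> by (intro Un_Cinfinite_bound)
  qed
  \<comment> \<open>The countable seed guarantees that the final set is infinite.\<close>
  obtain f :: "nat \<Rightarrow> 'a" where f: "inj f" "range f \<subseteq> topspace X"
    using assms(2) infinite_countable_subset by blast
  have "|range f| \<le>o |UNIV :: nat set|"
    by (rule card_of_image)
  also have "|UNIV :: nat set| =o natLeq"
    by (rule card_of_nat)
  also have "natLeq \<le>o ?\<mu>"
    using \<mu> natLeq_ordLeq_cinfinite by blast
  finally have "|range f| \<le>o ?\<mu>" .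
  then obtain Z where Z: "range f \<subseteq> Z" "|Z| \<le>o ?\<mu>"
    and closed: "\<forall>B\<subseteq>Z. |B| \<le>o \<kappa> \<longrightarrow> G B \<subseteq> Z"
    by (rule ex_closed_superset_bounded[OF \<kappa> \<mu> exp _ G_bound])
  \<comment> \<open>\<open>Z\<close> might contain elements outside the space; the seed survives the
    restriction.\<close>
  define Y where "Y = Z \<inter> topspace X"
  have "infinite Y"
    using f Z unfolding Y_def by (metis finite_subset infinite_UNIV_nat finite_imageD le_inf_iff)
  moreover have "openin X Y"
  proof (subst openin_subopen, intro ballI)
    fix x assume x: "x \<in> Y"
    have "|{x}| \<le>o \<kappa>"
      using \<kappa> by (intro Card_order_singl_ordLeq) (auto simp: cinfinite_def)
    then have "G {x} \<subseteq> Z"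
      using x by (intro closed[rule_format]) (auto simp: Y_def)
    moreover have "U x \<subseteq> G {x}"
      using x by (auto simp: G_def Y_def)
    moreover have Ux: "openin X (U x)" "x \<in> U x"
      using x U by (auto simp: Y_def)
    ultimately have "U x \<subseteq> Y"
      unfolding Y_def using openin_subset by blast
    then show "\<exists>T. openin X T \<and> x \<in> T \<and> T \<subseteq> Y"
      using Ux by blast
  qed
  moreover have "X closure_of Y \<subseteq> Y"
  proof
    fix x assume x: "x \<in> X closure_of Y"
    then have xX: "x \<in> topspace X"
      by (simp add: in_closure_of)
    \<comment> \<open>Closure at \<open>x\<close> is a local matter: as \<open>U x\<close> is an
      open neighbourhood of \<open>x\<close>, the small set \<open>Y \<inter> U x\<close> already
      has \<open>x\<close> in its closure.\<close>
    have "|Y \<inter> U x| \<le>o \<kappa>"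
      using U[OF xX] card_of_mono1[of "Y \<inter> U x" "U x"] ordLeq_transitive by blast
    then have "G (Y \<inter> U x) \<subseteq> Z"
      by (intro closed[rule_format]) (auto simp: Y_def)
    moreover have "x \<in> X closure_of (Y \<inter> U x)"
      using x U[OF xX] openin_Int_closure_of_subset by (metis IntI inf_commute subsetD)
    ultimately show "x \<in> Y"
      using xX by (auto simp: G_def Y_def)
  qed
  then have "closedin X Y"
    using closure_of_subset_eq Y_def by blast
  moreover have "|Y| \<le>o ?\<mu>"
    using Z(2) card_of_mono1[of Y Z] ordLeq_transitive by (auto simp: Y_def)
  ultimately show ?thesis
    by blast
qed

end
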